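(* Let $S$ be a semigroup and let $S_\omega$, $\omega\in\Omega$, denote the (vertex sets of the distinct) connected components of the upper non-nilpotent graph $\mathcal{N}_S$. (1) If $|S_\omega|>1$ for each $\omega\in\Omega$ and each connected component of $\mathcal{N}_S$ is complete, then $S$ is a band and each connected component $S_\omega$ is a subsemigroup of $S$. (2) If $S$ is a band and each connected component of $\mathcal{N}_S$ is complete, then $\mathcal{N}_S=\mathcal{M}_S$, the semigroup $S$ is a semilattice $\Omega$ of the semigroups $S_\alpha$ ($\alpha\in\Omega$), and for all distinct $\alpha,\beta\in\Omega$ either $S_\alpha\cup S_\beta$ is a trivial total ideal extension of $S_\alpha$ by $S_\beta$, or it is a trivial total ideal extension of $S_\beta$ by $S_\alpha$, or $S_\alpha S_\beta=S_{\alpha\beta}$ with $|S_{\alpha\beta}|=1$.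
   Context: For a semigroup $S$, $S^1$ denotes $S$ if $S$ has an identity, and otherwise $S$ with an identity $1$ adjoined. For $x,y\in S$ and $z_1,z_2,\ldots\in S^1$ define recursively $\lambda_0=x$, $\rho_0=y$, $\lambda_{n+1}=\lambda_n z_{n+1}\rho_n$, $\rho_{n+1}=\rho_n z_{n+1}\lambda_n$; write $\lambda_n(x,y,z_1,\ldots,z_n)$, $\rho_n(x,y,z_1,\ldots,z_n)$. A semigroup $S$ is nilpotent (in the sense of Malcev) if there is a positive integer $n$ with $\lambda_n(a,b,c_1,\ldots,c_n)=\rho_n(a,b,c_1,\ldots,c_n)$ for all $a,b\in S$, $c_1,\ldots,c_n\in S^1$. The upper non-nilpotent graph $\mathcal{N}_S$ has vertex set $S$, with distinct $x,y$ adjacent iff the subsemigroup $\langle x,y\rangle$ is not nilpotent. The non-commuting graph $\mathcal{M}_S$ has vertex set $S$, with distinct $x,y$ adjacent iff $xy\neq yx$. A connected component is complete if every two distinct vertices in it are adjacent (a one-vertex component is complete). A band is a semigroup all of whose elements are idempotent. A trivial total ideal extension of a semigroup $A$ by a semigroup $B$ is a semigroup that is the disjoint union $A\cup B$, contains $A$ and $B$ as subsemigroups with $A$ an ideal, and satisfies $ab=a=ba$ for all $a\in A$, $b\in B$. $S$ is a semilattice $\Omega$ of semigroups $S_\alpha$ ($\alpha\in\Omega$) if $S$ is the disjoint union of the subsemigroups $S_\alpha$, for all $\alpha,\beta\in\Omega$ there is $\gamma\in\Omega$ with $S_\alpha S_\beta\subseteq S_\gamma$, and the product on $\Omega$ defined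 by $\alpha\beta=\gamma$ when $S_\alpha S_\beta\subseteq S_\gamma$ is commutative (so that $\Omega$ is a semilattice). Here $S_\alpha S_\beta=\{st: s\in S_\alpha,\ t\in S_\beta\}$. *)

theory Defs
  imports
    "Graph_Theory.Pair_Digraph"
    "Graph_Theory.Digraph_Component"
    "HOL-Library.Set_Algebras"
    "HOL-Library.Disjoint_Sets"
begin

text \<open>
  The ambient semigroup is a type of class \<open>semigroup_mult\<close>; its subsemigroups are subsets of
  that type. The generated subsemigroup is \<open>subsemigroup hull {x, y}\<close>, and the product of
  two subsets is the one of \<open>HOL-Library.Set_Algebras\<close>.
\<close>

definition subsemigroup :: "'a::semigroup_mult set \<Rightarrow> bool" where
  "subsemigroup T \<longleftrightarrow> T \<noteq> {} \<and> (\<forall>x\<in>T. \<forall>y\<in>T. x * y \<in> T)"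

definition band :: "'a::semigroup_mult set \<Rightarrow> bool" where
  "band T \<longleftrightarrow> subsemigroup T \<and> (\<forall>x\<in>T. x * x = x)"

definition ideal_in :: "'a::semigroup_mult set \<Rightarrow> 'a set \<Rightarrow> bool" where
  "ideal_in A T \<longleftrightarrow>
     A \<noteq> {} \<and> A \<subseteq> T \<and> (\<forall>a\<in>A. \<forall>t\<in>T. a * t \<in> A \<and> t * a \<in> A)"


section \<open>Nilpotency in the sense of Malcev\<close>

definition has_identity :: "'a::semigroup_mult set \<Rightarrow> bool" where
  "has_identity T \<longleftrightarrow> (\<exists>e\<in>T. \<forall>x\<in>T. e * x = x \<and> x * e = x)"

text \<open>
  \<open>T\<^sup>1\<close> as a subset of the option type: \<open>None\<close> is the adjoined identity, which is present
  only if \<open>T\<close> itself has no identity.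
\<close>

definition adjoin_identity :: "'a::semigroup_mult set \<Rightarrow> 'a option set" where
  "adjoin_identity T = (if has_identity T then Some ` T else insert None (Some ` T))"

text \<open>The product \<open>x z y\<close> for \<open>x, y\<close> in \<open>T\<close> and \<open>z\<close> in \<open>T\<^sup>1\<close>; it always lies in \<open>T\<close>.\<close>

fun sandwich :: "'a::semigroup_mult \<Rightarrow> 'a option \<Rightarrow> 'a \<Rightarrow> 'a" where
  "sandwich x None y = x * y"
| "sandwich x (Some z) y = x * z * y"

text \<open>Only the entries \<open>z 1, \<dots>, z n\<close> of the sequence matter; \<open>z 0\<close> is never used.\<close>

fun malcev_lambda malcev_rho ::
  "'a::semigroup_mult \<Rightarrow> 'a \<Rightarrow> (nat \<Rightarrow> 'a option) \<Rightarrow> nat \<Rightarrow> 'a" where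
  "malcev_lambda x y z 0 = x"
| "malcev_lambda x y z (Suc n) =
     sandwich (malcev_lambda x y z n) (z (Suc n)) (malcev_rho x y z n)"
| "malcev_rho x y z 0 = y"
| "malcev_rho x y z (Suc n) =
     sandwich (malcev_rho x y z n) (z (Suc n)) (malcev_lambda x y z n)"

definition malcev_nilpotent :: "'a::semigroup_mult set \<Rightarrow> bool" where
  "malcev_nilpotent T \<longleftrightarrow>
     (\<exists>n>0. \<forall>a\<in>T. \<forall>b\<in>T. \<forall>c. (\<forall>i\<in>{1..n}. c i \<in> adjoin_identity T) \<longrightarrow>
        malcev_lambda a b c n = malcev_rho a b c n)"


section \<open>The graphs\<close>

text \<open>
  Undirected graphs are symmetric loop-free digraphs, given by their set of vertices and their
  set of ordered pairs of adjacent vertices. For a symmetric digraph the strongly connected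
  components of the library are the connected components of the undirected graph.
\<close>

definition upper_non_nilpotent_graph :: "'a::semigroup_mult pair_pre_digraph" where
  "upper_non_nilpotent_graph =
     \<lparr>pverts = UNIV, parcs = {(x, y). x \<noteq> y \<and> \<not> malcev_nilpotent (subsemigroup hull {x, y})}\<rparr>"

definition non_commuting_graph :: "'a::semigroup_mult pair_pre_digraph" where
  "non_commuting_graph = \<lparr>pverts = UNIV, parcs = {(x, y). x \<noteq> y \<and> x * y \<noteq> y * x}\<rparr>"

definition component_verts :: "'a pair_pre_digraph \<Rightarrow> 'a set set" where
  "component_verts G = pre_digraph.sccs_verts (with_proj G)"

definition complete_on :: "'a pair_pre_digraph \<Rightarrow> 'a set \<Rightarrow> bool" where
  "complete_on G C \<longleftrightarrow> (\<forall>x\<in>C. \<forall>y\<in>C. x \<noteq> y \<longrightarrow> (x, y) \<in> parcs G)"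


section \<open>Trivial total ideal extensions and semilattices of semigroups\<close>

definition trivial_total_ideal_extension ::
  "'a::semigroup_mult set \<Rightarrow> 'a set \<Rightarrow> 'a set \<Rightarrow> bool" where
  "trivial_total_ideal_extension T A B \<longleftrightarrow>
     subsemigroup T \<and> T = A \<union> B \<and> A \<inter> B = {} \<and>
     subsemigroup A \<and> subsemigroup B \<and> ideal_in A T \<and>
     (\<forall>a\<in>A. \<forall>b\<in>B. a * b = a \<and> b * a = a)"

text \<open>
  The index \<open>\<alpha>\<beta>\<close>. The description determines it uniquely when the nonempty sets
  \<open>S\<^sub>\<alpha>\<close> are pairwise disjoint and every \<open>S\<^sub>\<alpha>S\<^sub>\<beta>\<close> is contained in some \<open>S\<^sub>\<gamma>\<close>.
\<close>

definition index_mult ::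
  "'i set \<Rightarrow> ('i \<Rightarrow> 'a::semigroup_mult set) \<Rightarrow> 'i \<Rightarrow> 'i \<Rightarrow> 'i" where
  "index_mult I C \<alpha> \<beta> = (THE \<gamma>. \<gamma> \<in> I \<and> C \<alpha> * C \<beta> \<subseteq> C \<gamma>)"

definition semilattice_of_semigroups ::
  "'a::semigroup_mult set \<Rightarrow> 'i set \<Rightarrow> ('i \<Rightarrow> 'a set) \<Rightarrow> bool" where
  "semilattice_of_semigroups T I C \<longleftrightarrow>
     (\<Union>\<alpha>\<in>I. C \<alpha>) = T \<and> disjoint_family_on C I \<and>
     (\<forall>\<alpha>\<in>I. subsemigroup (C \<alpha>)) \<and>
     (\<forall>\<alpha>\<in>I. \<forall>\<beta>\<in>I. \<exists>\<gamma>\<in>I. C \<alpha> * C \<beta> \<subseteq> C \<gamma>) \<and>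
     (\<forall>\<alpha>\<in>I. \<forall>\<beta>\<in>I. index_mult I C \<alpha> \<beta> = index_mult I C \<beta> \<alpha>)"

end

theory Submission
  imports Defs
begin

text \<open>
  The edges of the upper non-nilpotent graph are easily controlled because nilpotency passes to
  subsemigroups. For (1): \<open>x\<^sup>2\<close> has a neighbour \<open>w\<close>, and then \<open>w\<close> is also a neighbour of \<open>x\<close>; so if
  \<open>x\<^sup>2 \<noteq> x\<close>, completeness would make \<open>x\<close> and \<open>x\<^sup>2\<close> adjacent, although they commute. In a band,
  non-commuting \<open>x, y\<close> produce a two-element left or right zero semigroup among
  \<open>xy, yx, xyx, yxy\<close>, so adjacency is non-commutation. If the components are complete, distinct
  elements commute exactly when they lie in different components. This makes every component a
  rectangular band, and everything in (2) follows by deciding which products commute.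
\<close>

section \<open>Malcev nilpotency\<close>

lemma subsemigroup_closed: "subsemigroup T \<Longrightarrow> x \<in> T \<Longrightarrow> y \<in> T \<Longrightarrow> x * y \<in> T"
  by (simp add: subsemigroup_def)

lemma subsemigroup_hull:
  assumes "A \<noteq> {}"
  shows "subsemigroup (subsemigroup hull A)"
proof -
  have "A \<subseteq> subsemigroup hull A" by (rule hull_subset)
  then show ?thesis
    using assms unfolding subsemigroup_def[of "_ hull _"]
    by (auto simp: hull_def subsemigroup_def)
qed

lemma sandwich_closed:
  assumes "subsemigroup T" "x \<in> T" "y \<in> T" "z \<in> adjoin_identity T"
  shows "sandwich x z y \<in> T"
  using assms
  by (cases z) (auto simp: adjoin_identity_def subsemigroup_closed split: if_splits)

lemma malcev_closed:
  assumes "subsemigroup T" "a \<in> T" "b \<in> T" "\<forall>i\<in>{1..n}. c i \<in> adjoin_identity T"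
  shows "malcev_lambda a b c n \<in> T \<and> malcev_rho a b c n \<in> T"
  using assms by (induction n) (simp_all add: sandwich_closed)

text \<open>The identity adjoined to \<open>U\<close> need not be adjoined to \<open>T\<close>: if
  \<open>T\<close> has its own identity, that element takes over the role of \<open>None\<close>;
  otherwise \<open>z\<close> itself serves.\<close>

lemma adjoin_identity_mono:
  assumes "U \<subseteq> T" "z \<in> adjoin_identity U"
  obtains z' where "z' \<in> adjoin_identity T"
    "\<And>x y. x \<in> T \<Longrightarrow> y \<in> T \<Longrightarrow> sandwich x z' y = sandwich x z y"
proof (cases "z = None \<and> has_identity T")
  case True
  then obtain e where e: "e \<in> T" "\<forall>x\<in>T. e * x = x \<and> x * e = x" and "has_identity T"
    by (auto simp: has_identity_def)
  then show ?thesis using True by (intro that[of "Some e"]) (auto simp: adjoin_identity_def)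
next
  case False
  then show ?thesis
    using assms by (intro that[of z]) (auto simp: adjoin_identity_def split: if_splits)
qed

text \<open>The same \<open>n\<close> works for \<open>U\<close>: exchanging the parameters for ones
  admissible in \<open>T\<close> that act equally on \<open>T\<close> changes no
  \<open>malcev_lambda\<close> and no \<open>malcev_rho\<close> up to step \<open>n\<close>.\<close>

lemma malcev_nilpotent_mono:
  assumes nil: "malcev_nilpotent T" and T: "subsemigroup T" and sub: "U \<subseteq> T"
  shows "malcev_nilpotent U"
proof -
  obtain n where n: "n > 0" and eq: "\<And>a b c. a \<in> T \<Longrightarrow> b \<in> T \<Longrightarrow>
      \<forall>i\<in>{1..n}. c i \<in> adjoin_identity T \<Longrightarrow> malcev_lambda a b c n = malcev_rho a b c n"
    using nil unfolding malcev_nilpotent_def by metis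
  have "malcev_lambda a b c n = malcev_rho a b c n"
    if ab: "a \<in> U" "b \<in> U" and c: "\<forall>i\<in>{1..n}. c i \<in> adjoin_identity U" for a b c
  proof -
    have "\<forall>i\<in>{1..n}. \<exists>z'. z' \<in> adjoin_identity T \<and>
        (\<forall>x\<in>T. \<forall>y\<in>T. sandwich x z' y = sandwich x (c i) y)"
      using c adjoin_identity_mono[OF sub] by metis
    then obtain d where d: "\<forall>i\<in>{1..n}. d i \<in> adjoin_identity T"
      and dc: "\<forall>i\<in>{1..n}. \<forall>x\<in>T. \<forall>y\<in>T. sandwich x (d i) y = sandwich x (c i) y"
      by metis
    have abT: "a \<in> T" "b \<in> T" using ab sub by auto
    have "malcev_lambda a b d m = malcev_lambda a b c m \<and> malcev_rho a b d m = malcev_rho a b c m"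
      if "m \<le> n" for m
      using that
    proof (induction m)
      case (Suc m)
      have "malcev_lambda a b d m \<in> T \<and> malcev_rho a b d m \<in> T"
        using Suc.prems d by (intro malcev_closed[OF T abT]) auto
      then show ?case using Suc dc by auto
    qed simp
    then show ?thesis using eq[OF abT d] by auto
  qed
  then show ?thesis using n unfolding malcev_nilpotent_def by blast
qed

text \<open>One step suffices, because commutativity already makes \<open>sandwich\<close> symmetric
  in its outer arguments.\<close>

lemma malcev_nilpotent_commutative:
  assumes T: "subsemigroup T" and comm: "\<And>x y. x \<in> T \<Longrightarrow> y \<in> T \<Longrightarrow> x * y = y * x"
  shows "malcev_nilpotent T"
proof -
  have "sandwich a z b = sandwich b z a" if "a \<in> T" "b \<in> T" "z \<in> adjoin_identity T" for a b z
  proof (cases z)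
    case (Some u)
    then have "u \<in> T" using that by (auto simp: adjoin_identity_def split: if_splits)
    then have "a * u * b = b * (u * a)"
      using that T comm by (metis subsemigroup_closed)
    then show ?thesis using Some by (simp add: mult.assoc)
  qed (use that comm in simp)
  then show ?thesis
    unfolding malcev_nilpotent_def by (intro exI[of _ 1]) auto
qed

lemma hull_commutative:
  assumes xy: "x * y = y * x" and z: "z \<in> subsemigroup hull {x, y}"
    and w: "w \<in> subsemigroup hull {x, y}"
  shows "z * w = w * z"
proof -
  \<comment> \<open>The centralizer of any set is closed under products, so it contains the hull as
    soon as it contains \<open>x\<close> and \<open>y\<close>. This is applied first to
    \<open>A = {x, y}\<close> and then to the hull itself.\<close>
  have centralizer: "subsemigroup hull {x, y} \<subseteq> {u. \<forall>v\<in>A. u * v = v * u}"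
    if "x \<in> {u. \<forall>v\<in>A. u * v = v * u}" "y \<in> {u. \<forall>v\<in>A. u * v = v * u}" for A
  proof (rule hull_minimal)
    show "subsemigroup {u. \<forall>v\<in>A. u * v = v * u}"
      using that unfolding subsemigroup_def by (auto, metis mult.assoc)
  qed (use that in auto)
  have "subsemigroup hull {x, y} \<subseteq> {u. \<forall>v\<in>{x, y}. u * v = v * u}"
    by (rule centralizer) (auto simp: xy)
  then have "subsemigroup hull {x, y} \<subseteq> {u. \<forall>v\<in>subsemigroup hull {x, y}. u * v = v * u}"
    by (intro centralizer) auto
  then show ?thesis using z w by auto
qed

lemma malcev_nilpotent_hull_commuting:
  "x * y = y * x \<Longrightarrow> malcev_nilpotent (subsemigroup hull {x, y})"
  by (rule malcev_nilpotent_commutative) (auto intro: subsemigroup_hull hull_commutative)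

text \<open>Taking all \<open>z\<^sub>i = a\<close>, the pair \<open>(\<lambda>\<^sub>n, \<rho>\<^sub>n)\<close> stays in \<open>{(a, b), (b, a)}\<close>.\<close>

lemma not_malcev_nilpotent_left_or_right_zero:
  assumes "a \<in> T" "b \<in> T" "a \<noteq> b" "a * a = a"
    and "a * b = a \<and> b * a = b \<or> a * b = b \<and> b * a = a"
  shows "\<not> malcev_nilpotent T"
proof
  assume "malcev_nilpotent T"
  then obtain n where "malcev_lambda a b (\<lambda>_. Some a) n = malcev_rho a b (\<lambda>_. Some a) n"
    unfolding malcev_nilpotent_def using assms(1,2)
    by (metis adjoin_identity_def imageI insertI2)
  moreover have "(malcev_lambda a b (\<lambda>_. Some a) n, malcev_rho a b (\<lambda>_. Some a) n)
      \<in> {(a, b), (b, a)}"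
    using assms by (induction n) (auto simp: mult.assoc)
  ultimately show False using assms by auto
qed

section \<open>Adjacency in a band\<close>

lemma band_idem: "band (UNIV :: 'a::semigroup_mult set) \<Longrightarrow> x * x = (x::'a)"
  by (simp add: band_def)

lemma malcev_nilpotent_hull_band_iff:
  fixes x y :: "'a::semigroup_mult"
  assumes "band (UNIV :: 'a set)"
  shows "malcev_nilpotent (subsemigroup hull {x, y}) \<longleftrightarrow> x * y = y * x"
proof
  note idem = band_idem[OF assms]
  \<comment> \<open>In products nested to the right, these rules delete a repeated letter or a
    repeated two-letter block, inside a word as well as at its end.\<close>
  have idem': "u * (u * v) = u * v" for u v :: 'a
    by (metis idem mult.assoc)
  have idem2: "u * (v * (u * v)) = u * v" for u v :: 'a
    by (metis idem mult.assoc)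
  have idem3: "u * (v * (u * (v * w))) = u * (v * w)" for u v w :: 'a
    by (metis idem mult.assoc)
  note simps = mult.assoc idem idem' idem2 idem3
  let ?T = "subsemigroup hull {x, y}"
  have T: "subsemigroup ?T" and "x \<in> ?T" "y \<in> ?T"
    by (auto simp: subsemigroup_hull hull_inc)
  then have inT: "x * y \<in> ?T" "y * x \<in> ?T" "x * y * x \<in> ?T" "y * x * y \<in> ?T"
    by (simp_all add: subsemigroup_closed)
  assume nil: "malcev_nilpotent ?T"
  \<comment> \<open>The elements \<open>x * y\<close> and \<open>x * y * x\<close> multiply as a
    right zero pair, so nilpotency forces them to coincide; the same holds with \<open>x\<close> and
    \<open>y\<close> exchanged.\<close>
  have "x * y = x * y * x"
  proof (rule ccontr)
    assume "x * y \<noteq> x * y * x"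
    from not_malcev_nilpotent_left_or_right_zero[OF inT(1) inT(3) this] nil
    show False by (simp add: simps)
  qed
  moreover have "y * x = y * x * y"
  proof (rule ccontr)
    assume "y * x \<noteq> y * x * y"
    from not_malcev_nilpotent_left_or_right_zero[OF inT(2) inT(4) this] nil
    show False by (simp add: simps)
  qed
  \<comment> \<open>Since \<open>x * y * (y * x)\<close> reduces to \<open>x * y * x\<close>, the
    two equations turn \<open>x * y\<close> and \<open>y * x\<close> into a left zero pair.\<close>
  ultimately have zero: "x * y * (y * x) = x * y" "y * x * (x * y) = y * x"
    by (simp_all add: simps)
  show "x * y = y * x"
  proof (rule ccontr)
    assume "x * y \<noteq> y * x"
    from not_malcev_nilpotent_left_or_right_zero[OF inT(1) inT(2) this] nil zero idem
    show False by simp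
  qed
qed (rule malcev_nilpotent_hull_commuting)

section \<open>Connected components\<close>

lemma component_verts_partition:
  assumes "pverts G = UNIV"
  shows "\<Union>(component_verts G) = UNIV"
    and "S \<in> component_verts G \<Longrightarrow> S \<noteq> {}"
    and "S \<in> component_verts G \<Longrightarrow> T \<in> component_verts G \<Longrightarrow> S \<noteq> T \<Longrightarrow> S \<inter> T = {}"
proof -
  interpret pair_wf_digraph G
    by unfold_locales (simp_all add: assms)
  show "\<Union>(component_verts G) = UNIV"
    unfolding component_verts_def
    using scc_of_in_sccs_verts in_scc_of_self assms by blast
  show "S \<in> component_verts G \<Longrightarrow> S \<noteq> {}"
    unfolding component_verts_def by (simp add: in_sccs_verts_conv_reachable)
  show "S \<in> component_verts G \<Longrightarrow> T \<in> component_verts G \<Longrightarrow> S \<noteq> T \<Longrightarrow> S \<inter> T = {}"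
    unfolding component_verts_def by (rule sccs_verts_disjoint)
qed

text \<open>Symmetry turns an arc into reachability in both directions, which is what a common
  strongly connected component requires.\<close>

lemma component_verts_adjacent:
  assumes verts: "pverts G = UNIV" and sym: "sym (parcs G)"
    and S: "S \<in> component_verts G" "x \<in> S" and xy: "(x, y) \<in> parcs G"
  shows "y \<in> S"
proof -
  interpret pair_wf_digraph G
    by unfold_locales (simp_all add: verts)
  have "(y, x) \<in> parcs G" using sym xy by (rule symD)
  then have "x \<rightarrow>\<^sup>*\<^bsub>with_proj G\<^esub> y" "y \<rightarrow>\<^sup>*\<^bsub>with_proj G\<^esub> x"
    using xy by auto
  then show ?thesis
    using S unfolding component_verts_def in_sccs_verts_conv_reachable by blast
qed

lemma upper_non_nilpotent_graph_simps:
  fixes x y :: "'a::semigroup_mult"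
  shows "pverts (upper_non_nilpotent_graph :: 'a pair_pre_digraph) = UNIV"
  and "(x, y) \<in> parcs upper_non_nilpotent_graph \<longleftrightarrow>
     x \<noteq> y \<and> \<not> malcev_nilpotent (subsemigroup hull {x, y})"
  by (simp_all add: upper_non_nilpotent_graph_def)

lemma sym_upper_non_nilpotent_graph: "sym (parcs upper_non_nilpotent_graph)"
  by (auto simp: sym_def upper_non_nilpotent_graph_simps insert_commute)

lemma upper_non_nilpotent_graph_band:
  assumes "band (UNIV :: 'a::semigroup_mult set)"
  shows "(upper_non_nilpotent_graph :: 'a pair_pre_digraph) = non_commuting_graph"
  by (simp add: upper_non_nilpotent_graph_def non_commuting_graph_def
      malcev_nilpotent_hull_band_iff[OF assms])

lemma idempotent_if_complete_components:
  fixes x :: "'a::semigroup_mult"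
  defines "G \<equiv> (upper_non_nilpotent_graph :: 'a pair_pre_digraph)"
  assumes complete: "\<And>S. S \<in> component_verts G \<Longrightarrow> complete_on G S"
    and nontrivial: "\<And>S. S \<in> component_verts G \<Longrightarrow> \<exists>u\<in>S. \<exists>v\<in>S. u \<noteq> v"
  shows "x * x = x"
proof (rule ccontr)
  assume xx: "x * x \<noteq> x"
  note simps = upper_non_nilpotent_graph_simps[where 'a = 'a, folded G_def]
  note adjacent = component_verts_adjacent[OF simps(1)
      sym_upper_non_nilpotent_graph[where 'a = 'a, folded G_def]]
  obtain S where S: "S \<in> component_verts G" "x * x \<in> S"
    using component_verts_partition(1)[OF simps(1)] by blast
  then obtain w where "w \<in> S" "w \<noteq> x * x"
    using nontrivial by metis
  then have edge: "(x * x, w) \<in> parcs G"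
    using complete[OF S(1)] S(2) by (auto simp: complete_on_def)
  have comm: "x * x * x = x * (x * x)" by (simp add: mult.assoc)
  \<comment> \<open>The edge cannot end in \<open>x\<close>, which commutes with its square.\<close>
  have "w \<noteq> x"
    using edge malcev_nilpotent_hull_commuting[OF comm] by (auto simp: simps)
  \<comment> \<open>If the hull of \<open>x\<close> and \<open>w\<close> were nilpotent, so would be
    the smaller hull of \<open>x * x\<close> and \<open>w\<close>, against the edge.\<close>
  have "subsemigroup hull {x * x, w} \<subseteq> subsemigroup hull {x, w}"
  proof (rule hull_minimal)
    show hull: "subsemigroup (subsemigroup hull {x, w})" by (simp add: subsemigroup_hull)
    show "{x * x, w} \<subseteq> subsemigroup hull {x, w}"
      using subsemigroup_closed[OF hull] by (simp add: hull_inc)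
  qed
  then have "\<not> malcev_nilpotent (subsemigroup hull {x, w})"
    using edge malcev_nilpotent_mono[OF _ subsemigroup_hull[OF insert_not_empty]]
    unfolding simps by metis
  then have "(w, x) \<in> parcs G"
    using \<open>w \<noteq> x\<close> by (simp add: simps insert_commute)
  then have "x \<in> S" using adjacent[OF S(1) \<open>w \<in> S\<close>] by simp
  then have "(x * x, x) \<in> parcs G"
    using complete[OF S(1)] S(2) xx by (auto simp: complete_on_def)
  then show False using malcev_nilpotent_hull_commuting[OF comm] by (simp add: simps)
qed

section \<open>Bands in which non-commutation is transitive\<close>

text \<open>Isolates what the band argument needs from the graph: by the last two assumptions,
  distinct elements fail to commute exactly when they share a block
  \<open>C \<alpha>\<close>.\<close>

locale noncommuting_partition =
  fixes \<Omega> :: "'i set" and C :: "'i \<Rightarrow> 'a::semigroup_mult set"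
  assumes idem: "x * x = (x::'a)"
    and nonempty: "\<alpha> \<in> \<Omega> \<Longrightarrow> C \<alpha> \<noteq> {}"
    and cover: "(\<Union>\<alpha>\<in>\<Omega>. C \<alpha>) = UNIV"
    and disjoint: "disjoint_family_on C \<Omega>"
    and noncommuting_in: "\<alpha> \<in> \<Omega> \<Longrightarrow> x \<in> C \<alpha> \<Longrightarrow> x * y \<noteq> y * x \<Longrightarrow> y \<in> C \<alpha>"
    and commuting_eq: "\<alpha> \<in> \<Omega> \<Longrightarrow> x \<in> C \<alpha> \<Longrightarrow> y \<in> C \<alpha> \<Longrightarrow> x * y = y * x \<Longrightarrow> x = y"
begin

lemma index_unique: "\<alpha> \<in> \<Omega> \<Longrightarrow> \<beta> \<in> \<Omega> \<Longrightarrow> x \<in> C \<alpha> \<Longrightarrow> x \<in> C \<beta> \<Longrightarrow> \<alpha> = \<beta>"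
  using disjoint by (auto simp: disjoint_family_on_def)

lemma commute: "\<alpha> \<in> \<Omega> \<Longrightarrow> \<beta> \<in> \<Omega> \<Longrightarrow> \<alpha> \<noteq> \<beta> \<Longrightarrow> x \<in> C \<alpha> \<Longrightarrow> y \<in> C \<beta> \<Longrightarrow> x * y = y * x"
  using noncommuting_in index_unique by metis

lemma mult_left_idem: "x * (x * y) = x * (y::'a)"
  by (metis idem mult.assoc)

text \<open>A product outside the block would commute with both factors, giving
  \<open>x * y * x = x * y = y * x * y\<close>. Then \<open>y * x\<close>, being its own square,
  equals \<open>x * y\<close>, so \<open>x = y\<close> and the product is in the block after
  all.\<close>

lemma closed:
  assumes "\<alpha> \<in> \<Omega>" "x \<in> C \<alpha>" "y \<in> C \<alpha>"
  shows "x * y \<in> C \<alpha>"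
proof (rule ccontr)
  assume "x * y \<notin> C \<alpha>"
  then have "x * (x * y) = x * y * x" "y * (x * y) = x * y * y"
    using noncommuting_in assms by metis+
  then have xyx: "x * y * x = x * y" and yxy: "y * x * y = x * y"
    by (metis idem mult.assoc)+
  have "y * x = y * (x * y * x)" using idem[of "y * x"] by (simp add: mult.assoc)
  also have "\<dots> = x * y" using xyx yxy by (metis mult.assoc)
  finally have "x * y = y * x" by simp
  then have "x = y" using commuting_eq assms by simp
  then show False using \<open>x * y \<notin> C \<alpha>\<close> assms idem by simp
qed

lemma subsemigroup_component: "\<alpha> \<in> \<Omega> \<Longrightarrow> subsemigroup (C \<alpha>)"
  using nonempty closed by (simp add: subsemigroup_def)

text \<open>Both products of \<open>x * y * x\<close> with \<open>x\<close> reduce to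
  \<open>x * y * x\<close>, and commuting elements of one block are equal.\<close>

lemma rectangular:
  assumes "\<alpha> \<in> \<Omega>" "x \<in> C \<alpha>" "y \<in> C \<alpha>"
  shows "x * y * x = x"
proof (rule commuting_eq[OF assms(1)])
  show "x * y * x * x = x * (x * y * x)"
    by (simp add: mult.assoc mult_left_idem idem)
qed (use assms closed in auto)

section \<open>Products of blocks\<close>

text \<open>The products of \<open>a * b\<close> and \<open>a' * b\<close> in the two orders are
  \<open>a * a' * b\<close> and \<open>a' * a * b\<close>. If these differ, the two elements do not
  commute and share a block; if they agree, rectangularity collapses both sides to
  \<open>a * b = a' * b\<close>.\<close>

lemma mult_right_in_component:
  assumes "\<alpha> \<in> \<Omega>" "\<beta> \<in> \<Omega>" "\<alpha> \<noteq> \<beta>" "a \<in> C \<alpha>" "a' \<in> C \<alpha>" "b \<in> C \<beta>" "\<gamma> \<in> \<Omega>" "a * b \<in> C \<gamma>"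
  shows "a' * b \<in> C \<gamma>"
proof (cases "a * a' * b = a' * a * b")
  case True
  have "a * b = a * a' * a * b" using assms rectangular by simp
  also have "\<dots> = a * a' * b" using True by (metis mult.assoc mult_left_idem)
  also have "\<dots> = a' * a * b" by (rule True)
  also have "\<dots> = a' * a * a' * b" using True by (metis mult.assoc mult_left_idem)
  also have "\<dots> = a' * b" using assms rectangular by simp
  finally show ?thesis using assms by simp
next
  case False
  have "a * b = b * a" "a' * b = b * a'" using assms commute by auto
  then have "a * b * (a' * b) = a * a' * b" "a' * b * (a * b) = a' * a * b"
    by (metis idem mult.assoc)+
  with False show ?thesis using noncommuting_in assms by metis
qed

text \<open>The factors are exchanged one at a time: first \<open>a\<close> for \<open>a'\<close>,
  then, after commuting, \<open>b\<close> for \<open>b'\<close> with the roles of the blocks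
  swapped.\<close>

lemma product_in_component:
  assumes "\<alpha> \<in> \<Omega>" "\<beta> \<in> \<Omega>"
  shows "\<exists>\<gamma>\<in>\<Omega>. C \<alpha> * C \<beta> \<subseteq> C \<gamma>"
proof (cases "\<alpha> = \<beta>")
  case True
  then show ?thesis using assms closed by (auto simp: set_times_def)
next
  case False
  obtain a b where a: "a \<in> C \<alpha>" and b: "b \<in> C \<beta>"
    using assms(1,2) nonempty by (metis ex_in_conv)
  obtain \<gamma> where \<gamma>: "\<gamma> \<in> \<Omega>" "a * b \<in> C \<gamma>" using cover by blast
  have "a' * b' \<in> C \<gamma>" if "a' \<in> C \<alpha>" "b' \<in> C \<beta>" for a' b'
  proof -
    have "b * a' \<in> C \<gamma>"
      using mult_right_in_component[OF assms False a that(1) b \<gamma>] commute assms False that(1) b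
      by metis
    then have "b' * a' \<in> C \<gamma>"
      using mult_right_in_component[OF assms(2,1) _ b that(2,1) \<gamma>(1)] False by simp
    then show ?thesis using commute assms False that by metis
  qed
  then show ?thesis using \<gamma>(1) by (auto simp: set_times_def)
qed

text \<open>Blocks are nonempty and disjoint, so a single product \<open>a * b\<close> already pins
  down the index.\<close>

lemma index_mult_eq:
  assumes "\<alpha> \<in> \<Omega>" "\<beta> \<in> \<Omega>" "\<gamma> \<in> \<Omega>" "C \<alpha> * C \<beta> \<subseteq> C \<gamma>"
  shows "index_mult \<Omega> C \<alpha> \<beta> = \<gamma>"
  unfolding index_mult_def
proof (rule the_equality)
  obtain a b where "a \<in> C \<alpha>" "b \<in> C \<beta>" using assms(1,2) nonempty by (metis ex_in_conv)
  then have "a * b \<in> C \<alpha> * C \<beta>" by (rule set_times_intro)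
  then show "\<delta> = \<gamma>" if "\<delta> \<in> \<Omega> \<and> C \<alpha> * C \<beta> \<subseteq> C \<delta>" for \<delta>
    using that assms index_unique by blast
qed (use assms in simp)

lemma product_commute:
  assumes "\<alpha> \<in> \<Omega>" "\<beta> \<in> \<Omega>"
  shows "C \<alpha> * C \<beta> = C \<beta> * C \<alpha>"
proof (cases "\<alpha> = \<beta>")
  case False
  then show ?thesis
    using commute[OF assms] unfolding set_times_def by (auto, metis+)
qed simp

text \<open>The index of a product depends only on the product set, which is symmetric by
  \<open>product_commute\<close>.\<close>

lemma semilattice: "semilattice_of_semigroups UNIV \<Omega> C"
  unfolding semilattice_of_semigroups_def index_mult_def
  using cover disjoint subsemigroup_component product_in_component product_commute by auto

section \<open>The three cases for two distinct blocks\<close>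

text \<open>Since \<open>a * b = b * a\<close>, the element \<open>a * b\<close> commutes with
  \<open>a\<close>; both lie in \<open>C \<alpha>\<close>, hence they are equal.\<close>

lemma trivial_total_ideal_extension_if_absorbing:
  assumes "\<alpha> \<in> \<Omega>" "\<beta> \<in> \<Omega>" "\<alpha> \<noteq> \<beta>" "C \<alpha> * C \<beta> \<subseteq> C \<alpha>"
  shows "trivial_total_ideal_extension (C \<alpha> \<union> C \<beta>) (C \<alpha>) (C \<beta>)"
proof -
  have ab: "a * b = a \<and> b * a = a" if "a \<in> C \<alpha>" "b \<in> C \<beta>" for a b
  proof -
    have comm: "a * b = b * a" using that assms commute by simp
    have "a * b * a = a * (a * b)"
      by (metis comm mult.assoc)
    moreover have "a * b \<in> C \<alpha>" using assms(4) set_times_intro[OF that] by auto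
    ultimately have "a * b = a" using commuting_eq assms(1) that(1) by metis
    then show ?thesis using comm by simp
  qed
  have "C \<alpha> \<inter> C \<beta> = {}" using assms disjoint by (auto simp: disjoint_family_on_def)
  then show ?thesis
    unfolding trivial_total_ideal_extension_def ideal_in_def
    using assms(1,2) ab closed subsemigroup_component nonempty
    by (auto simp: subsemigroup_def)
qed

text \<open>Any \<open>g\<close> in the third block commutes with \<open>a\<close> and with
  \<open>b\<close>, hence with \<open>a * b\<close>, which lies in the same block as
  \<open>g\<close>; so \<open>g = a * b\<close>.\<close>

lemma product_singleton:
  assumes "\<alpha> \<in> \<Omega>" "\<beta> \<in> \<Omega>" "\<gamma> \<in> \<Omega>" "\<gamma> \<noteq> \<alpha>" "\<gamma> \<noteq> \<beta>" "C \<alpha> * C \<beta> \<subseteq> C \<gamma>"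
  shows "C \<alpha> * C \<beta> = C \<gamma> \<and> card (C \<gamma>) = 1"
proof -
  obtain a b where a: "a \<in> C \<alpha>" and b: "b \<in> C \<beta>"
    using assms(1,2) nonempty by (metis ex_in_conv)
  have "g = a * b" if "g \<in> C \<gamma>" for g
  proof (rule commuting_eq[OF assms(3) that])
    show "a * b \<in> C \<gamma>" using assms(6) set_times_intro[OF a b] by auto
    have "g * a = a * g" "g * b = b * g" using commute assms a b that by auto
    then show "g * (a * b) = a * b * g" by (metis mult.assoc)
  qed
  moreover have "a * b \<in> C \<alpha> * C \<beta>" using a b by (rule set_times_intro)
  ultimately have "C \<gamma> = {a * b}" "C \<alpha> * C \<beta> = {a * b}" using assms(6) by auto
  then show ?thesis by simp
qed

lemma trichotomy:
  assumes "\<alpha> \<in> \<Omega>" "\<beta> \<in> \<Omega>" "\<alpha> \<noteq> \<beta>"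
  shows "trivial_total_ideal_extension (C \<alpha> \<union> C \<beta>) (C \<alpha>) (C \<beta>) \<or>
    trivial_total_ideal_extension (C \<alpha> \<union> C \<beta>) (C \<beta>) (C \<alpha>) \<or>
    (C \<alpha> * C \<beta> = C (index_mult \<Omega> C \<alpha> \<beta>) \<and> card (C (index_mult \<Omega> C \<alpha> \<beta>)) = 1)"
proof -
  obtain \<gamma> where \<gamma>: "\<gamma> \<in> \<Omega>" "C \<alpha> * C \<beta> \<subseteq> C \<gamma>"
    using product_in_component assms by blast
  consider "\<gamma> = \<alpha>" | "\<gamma> = \<beta>" | "\<gamma> \<noteq> \<alpha>" "\<gamma> \<noteq> \<beta>" by blast
  then show ?thesis
  proof cases
    case 1
    then show ?thesis using trivial_total_ideal_extension_if_absorbing assms \<gamma> by simp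
  next
    case 2
    then show ?thesis
      using trivial_total_ideal_extension_if_absorbing[OF assms(2,1)] assms \<gamma> product_commute
      by (simp add: Un_commute)
  next
    case 3
    then show ?thesis using product_singleton index_mult_eq assms \<gamma> by metis
  qed
qed

end

lemma noncommuting_partition_components:
  fixes C :: "'i \<Rightarrow> 'a::semigroup_mult set"
  assumes components:
      "bij_betw C \<Omega> (component_verts (upper_non_nilpotent_graph :: 'a pair_pre_digraph))"
    and band: "band (UNIV :: 'a set)"
    and complete: "\<forall>\<omega>\<in>\<Omega>. complete_on upper_non_nilpotent_graph (C \<omega>)"
  shows "noncommuting_partition \<Omega> C"
proof
  note partition = component_verts_partition[OF upper_non_nilpotent_graph_simps(1)[where 'a = 'a]]
  have image: "C ` \<Omega> = component_verts upper_non_nilpotent_graph" and inj: "inj_on C \<Omega>"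
    using components by (auto simp: bij_betw_def)
  then have C: "C \<alpha> \<in> component_verts upper_non_nilpotent_graph" if "\<alpha> \<in> \<Omega>" for \<alpha>
    using that by auto
  show "x * x = x" for x :: 'a by (rule band_idem[OF band])
  show "C \<alpha> \<noteq> {}" if "\<alpha> \<in> \<Omega>" for \<alpha> using partition(2) C[OF that] .
  show "(\<Union>\<alpha>\<in>\<Omega>. C \<alpha>) = UNIV" using partition(1) image by simp
  \<comment> \<open>Injectivity of the indexing is essential: distinct indices must name distinct
    components.\<close>
  show "disjoint_family_on C \<Omega>"
    unfolding disjoint_family_on_def using partition(3) C inj by (metis inj_onD)
  show "y \<in> C \<alpha>" if "\<alpha> \<in> \<Omega>" "x \<in> C \<alpha>" "x * y \<noteq> y * x" for \<alpha> x y
    using that malcev_nilpotent_hull_band_iff[OF band]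
    by (intro component_verts_adjacent[OF _ _ C[OF that(1)] that(2)])
      (auto simp: upper_non_nilpotent_graph_simps sym_upper_non_nilpotent_graph)
  show "x = y" if "\<alpha> \<in> \<Omega>" "x \<in> C \<alpha>" "y \<in> C \<alpha>" "x * y = y * x" for \<alpha> x y
    using that complete malcev_nilpotent_hull_commuting
    unfolding complete_on_def upper_non_nilpotent_graph_simps by metis
qed

theorem theorem3p7:
  fixes \<Omega> :: "'i set"
    and C :: "'i \<Rightarrow> 'a::semigroup_mult set"
  assumes components:
    "bij_betw C \<Omega> (component_verts (upper_non_nilpotent_graph :: 'a pair_pre_digraph))"
  shows
    "((\<forall>\<omega>\<in>\<Omega>. \<exists>x\<in>C \<omega>. \<exists>y\<in>C \<omega>. x \<noteq> y) \<and>
      (\<forall>\<omega>\<in>\<Omega>. complete_on upper_non_nilpotent_graph (C \<omega>)) \<longrightarrow>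
        band (UNIV :: 'a set) \<and> (\<forall>\<omega>\<in>\<Omega>. subsemigroup (C \<omega>)))
     \<and>
     (band (UNIV :: 'a set) \<and>
      (\<forall>\<omega>\<in>\<Omega>. complete_on upper_non_nilpotent_graph (C \<omega>)) \<longrightarrow>
        (upper_non_nilpotent_graph :: 'a pair_pre_digraph) = non_commuting_graph \<and>
        semilattice_of_semigroups UNIV \<Omega> C \<and>
        (\<forall>\<alpha>\<in>\<Omega>. \<forall>\<beta>\<in>\<Omega>. \<alpha> \<noteq> \<beta> \<longrightarrow>
           trivial_total_ideal_extension (C \<alpha> \<union> C \<beta>) (C \<alpha>) (C \<beta>) \<or>
           trivial_total_ideal_extension (C \<alpha> \<union> C \<beta>) (C \<beta>) (C \<alpha>) \<or>
           (C \<alpha> * C \<beta> = C (index_mult \<Omega> C \<alpha> \<beta>) \<and>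
            card (C (index_mult \<Omega> C \<alpha> \<beta>)) = 1)))"
proof (intro conjI impI)
  assume hyps: "(\<forall>\<omega>\<in>\<Omega>. \<exists>x\<in>C \<omega>. \<exists>y\<in>C \<omega>. x \<noteq> y) \<and>
    (\<forall>\<omega>\<in>\<Omega>. complete_on upper_non_nilpotent_graph (C \<omega>))"
  have image: "C ` \<Omega> = component_verts upper_non_nilpotent_graph"
    using components by (simp add: bij_betw_def)
  have "x * x = x" for x :: 'a
  proof (rule idempotent_if_complete_components)
    fix S :: "'a set"
    assume "S \<in> component_verts upper_non_nilpotent_graph"
    then obtain \<omega> where "\<omega> \<in> \<Omega>" "S = C \<omega>" using image by blast
    then show "complete_on upper_non_nilpotent_graph S" "\<exists>u\<in>S. \<exists>v\<in>S. u \<noteq> v"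
      using hyps by auto
  qed
  then show band: "band (UNIV :: 'a set)"
    by (simp add: band_def subsemigroup_def)
  \<comment> \<open>With the band property established, the components satisfy the block
    assumptions, and closure is read off from there.\<close>
  then interpret noncommuting_partition \<Omega> C
    using components hyps by (intro noncommuting_partition_components) auto
  show "\<forall>\<omega>\<in>\<Omega>. subsemigroup (C \<omega>)" using subsemigroup_component by simp
next
  assume hyps: "band (UNIV :: 'a set) \<and>
    (\<forall>\<omega>\<in>\<Omega>. complete_on upper_non_nilpotent_graph (C \<omega>))"
  then interpret noncommuting_partition \<Omega> C
    using components by (intro noncommuting_partition_components) auto
  show "(upper_non_nilpotent_graph :: 'a pair_pre_digraph) = non_commuting_graph"
    using hyps upper_non_nilpotent_graph_band by blast
  show "semilattice_of_semigroups UNIV \<Omega> C" by (rule semilattice)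
  show "\<forall>\<alpha>\<in>\<Omega>. \<forall>\<beta>\<in>\<Omega>. \<alpha> \<noteq> \<beta> \<longrightarrow>
      trivial_total_ideal_extension (C \<alpha> \<union> C \<beta>) (C \<alpha>) (C \<beta>) \<or>
      trivial_total_ideal_extension (C \<alpha> \<union> C \<beta>) (C \<beta>) (C \<alpha>) \<or>
      (C \<alpha> * C \<beta> = C (index_mult \<Omega> C \<alpha> \<beta>) \<and> card (C (index_mult \<Omega> C \<alpha> \<beta>)) = 1)"
    using trichotomy by blast
qed

end
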